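(* Let $R$ be a relation on $X\times Y$, with both $X$ and $Y$ nonempty. If $\Phi_R$ contains no free faces, then $R$ preserves attribute privacy.
   Context: Everything is finite. A relation $R$ on $X\times Y$ is a subset of $X\times Y$. $Y_x=\{y\in Y:(x,y)\in R\}$ and $X_y=\{x\in X:(x,y)\in R\}$. For $\sigma\subseteq X$, $\phi_R(\sigma)=\bigcap_{x\in\sigma}Y_x$ with $\phi_R(\emptyset)=Y$; for $\gamma\subseteq Y$, $\psi_R(\gamma)=\bigcap_{y\in\gamma}X_y$ with $\psi_R(\emptyset)=X$. $\Phi_R$ is the simplicial complex $\{\gamma\subseteq Y:\exists x\in X\ \forall y\in\gamma\ (x,y)\in R\}$, which contains $\emptyset$ as a simplex. $R$ preserves attribute privacy if $(\phi_R\circ\psi_R)(\gamma)=\gamma$ for all $\gamma\in\Phi_R$ (including $\gamma=\emptyset$). A simplex of a simplicial complex is a free face if it is a proper subset of exactly one maximal simplex of the complex; the empty simplex may be a free face. *)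

theory Defs
  imports Main
begin

definition row :: "'b set \<Rightarrow> ('a \<times> 'b) set \<Rightarrow> 'a \<Rightarrow> 'b set" where
  "row Y R x = {y \<in> Y. (x, y) \<in> R}"

definition col :: "'a set \<Rightarrow> ('a \<times> 'b) set \<Rightarrow> 'b \<Rightarrow> 'a set" where
  "col X R y = {x \<in> X. (x, y) \<in> R}"

text \<open>The empty intersection in the library is \<open>UNIV\<close>; here it has to be the
  ambient set \<open>Y\<close> (respectively \<open>X\<close>).\<close>

definition phi :: "'b set \<Rightarrow> ('a \<times> 'b) set \<Rightarrow> 'a set \<Rightarrow> 'b set" where
  "phi Y R \<sigma> = (if \<sigma> = {} then Y else (\<Inter>x\<in>\<sigma>. row Y R x))"

definition psi :: "'a set \<Rightarrow> ('a \<times> 'b) set \<Rightarrow> 'b set \<Rightarrow> 'a set" where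
  "psi X R \<gamma> = (if \<gamma> = {} then X else (\<Inter>y\<in>\<gamma>. col X R y))"

definition attribute_complex :: "'a set \<Rightarrow> 'b set \<Rightarrow> ('a \<times> 'b) set \<Rightarrow> 'b set set" where
  "attribute_complex X Y R = {\<gamma>. \<gamma> \<subseteq> Y \<and> (\<exists>x\<in>X. \<forall>y\<in>\<gamma>. (x, y) \<in> R)}"

definition preserves_attribute_privacy :: "'a set \<Rightarrow> 'b set \<Rightarrow> ('a \<times> 'b) set \<Rightarrow> bool" where
  "preserves_attribute_privacy X Y R \<longleftrightarrow>
     (\<forall>\<gamma>\<in>attribute_complex X Y R. (phi Y R \<circ> psi X R) \<gamma> = \<gamma>)"

text \<open>A simplicial complex is represented by its set of simplices, the empty simplex
  included.\<close>

definition maximal_simplex :: "'b set set \<Rightarrow> 'b set \<Rightarrow> bool" where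
  "maximal_simplex K \<mu> \<longleftrightarrow> \<mu> \<in> K \<and> (\<forall>\<tau>\<in>K. \<mu> \<subseteq> \<tau> \<longrightarrow> \<tau> = \<mu>)"

definition free_face :: "'b set set \<Rightarrow> 'b set \<Rightarrow> bool" where
  "free_face K \<sigma> \<longleftrightarrow> \<sigma> \<in> K \<and> (\<exists>!\<mu>. maximal_simplex K \<mu> \<and> \<sigma> \<subset> \<mu>)"

end

theory Submission
  imports Defs
begin

text \<open>If privacy fails at \<open>\<gamma>\<close>, some attribute \<open>y \<notin> \<gamma>\<close> is implied by \<open>\<gamma>\<close>, so every
  simplex containing \<open>\<gamma>\<close> remains a simplex when \<open>y\<close> is added. Enlarge \<open>\<gamma>\<close> to an
  inclusion-maximal simplex \<open>\<sigma>\<close> avoiding \<open>y\<close>. Removing \<open>y\<close> from a simplex containing \<open>\<sigma>\<close>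
  gives back \<open>\<sigma>\<close>, so \<open>\<sigma> \<union> {y}\<close> is the only maximal simplex above \<open>\<sigma>\<close>, which is
  thus a free face.\<close>

text \<open>The convention for the empty intersection covers \<open>\<gamma> = {}\<close>;
  \<open>\<gamma> \<subseteq> Y\<close> matters because \<open>row\<close> is cut down to
  \<open>Y\<close>.\<close>

lemma mem_psi_iff: "\<gamma> \<subseteq> Y \<Longrightarrow> x \<in> psi X R \<gamma> \<longleftrightarrow> x \<in> X \<and> \<gamma> \<subseteq> row Y R x"
  by (auto simp: psi_def col_def row_def)

lemma mem_phi_iff: "y \<in> phi Y R \<sigma> \<longleftrightarrow> y \<in> Y \<and> (\<forall>x\<in>\<sigma>. y \<in> row Y R x)"
  by (auto simp: phi_def row_def)

lemma mem_attribute_complex_iff: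
  "\<gamma> \<in> attribute_complex X Y R \<longleftrightarrow> (\<exists>x\<in>X. \<gamma> \<subseteq> row Y R x)"
  by (auto simp: attribute_complex_def row_def)

text \<open>The part of the argument free of relations: the simplices above \<open>\<gamma>\<close>
  behave like a cone with apex \<open>y\<close>.\<close>

lemma free_face_if_always_extendable:
  assumes "finite K" and down: "\<And>\<sigma> \<tau>. \<tau> \<in> K \<Longrightarrow> \<sigma> \<subseteq> \<tau> \<Longrightarrow> \<sigma> \<in> K"
    and "\<gamma> \<in> K" and "y \<notin> \<gamma>"
    and extend: "\<And>\<tau>. \<tau> \<in> K \<Longrightarrow> \<gamma> \<subseteq> \<tau> \<Longrightarrow> insert y \<tau> \<in> K"
  shows "\<exists>\<sigma>. free_face K \<sigma>"
proof -
  let ?A = "{\<sigma> \<in> K. y \<notin> \<sigma>}"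
  have "finite ?A" and "\<gamma> \<in> ?A" using assms by auto
  then obtain \<sigma> where "\<sigma> \<in> ?A" and "\<gamma> \<subseteq> \<sigma>"
    and max: "\<forall>\<tau>\<in>?A. \<sigma> \<subseteq> \<tau> \<longrightarrow> \<sigma> = \<tau>"
    using finite_has_maximal2[of ?A \<gamma>] by auto
  have above: "\<tau> - {y} = \<sigma>" if "\<tau> \<in> K" and "\<sigma> \<subseteq> \<tau>" for \<tau>
  proof -
    have "\<tau> - {y} \<in> K" using down[OF \<open>\<tau> \<in> K\<close>] by blast
    moreover have "\<sigma> \<subseteq> \<tau> - {y}" using that \<open>\<sigma> \<in> ?A\<close> by blast
    ultimately show ?thesis using max by blast
  qed
  have "insert y \<sigma> \<in> K" using extend \<open>\<sigma> \<in> ?A\<close> \<open>\<gamma> \<subseteq> \<sigma>\<close> by blast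
  \<comment> \<open>By \<open>above\<close>, only \<open>\<sigma>\<close> and
    \<open>insert y \<sigma>\<close> contain \<open>\<sigma>\<close>; this yields both maximality
    and uniqueness.\<close>
  then have "maximal_simplex K (insert y \<sigma>)"
    unfolding maximal_simplex_def using above by blast
  moreover have "\<mu> = insert y \<sigma>" if "maximal_simplex K \<mu>" and "\<sigma> \<subset> \<mu>" for \<mu>
    using that above[of \<mu>] unfolding maximal_simplex_def by blast
  ultimately have "free_face K \<sigma>"
    unfolding free_face_def using \<open>\<sigma> \<in> ?A\<close> by blast
  then show ?thesis ..
qed

theorem lemma62:
  fixes X :: "'a set" and Y :: "'b set" and R :: "('a \<times> 'b) set"
  assumes "finite X" and "finite Y"
    and "X \<noteq> {}" and "Y \<noteq> {}"
    and "R \<subseteq> X \<times> Y"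
    and "\<nexists>\<sigma>. free_face (attribute_complex X Y R) \<sigma>"
  shows "preserves_attribute_privacy X Y R"
proof (rule ccontr)
  let ?K = "attribute_complex X Y R"
  assume "\<not> ?thesis"
  then obtain \<gamma> where "\<gamma> \<in> ?K" and neq: "phi Y R (psi X R \<gamma>) \<noteq> \<gamma>"
    by (auto simp: preserves_attribute_privacy_def)
  then have "\<gamma> \<subseteq> Y" by (simp add: attribute_complex_def)
  \<comment> \<open>The closure never loses attributes, so privacy can fail only through an extra
    one.\<close>
  have "\<gamma> \<subseteq> phi Y R (psi X R \<gamma>)"
  proof
    fix z
    assume "z \<in> \<gamma>"
    then show "z \<in> phi Y R (psi X R \<gamma>)"
      using \<open>\<gamma> \<subseteq> Y\<close> mem_psi_iff[OF \<open>\<gamma> \<subseteq> Y\<close>] by (metis mem_phi_iff subsetD)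
  qed
  with neq obtain y where "y \<notin> \<gamma>" and y: "y \<in> phi Y R (psi X R \<gamma>)" by blast
  have "finite ?K"
    using \<open>finite Y\<close> by (auto simp: attribute_complex_def intro: finite_subset[of _ "Pow Y"])
  moreover have "\<sigma> \<in> ?K" if "\<tau> \<in> ?K" and "\<sigma> \<subseteq> \<tau>" for \<sigma> \<tau>
    using that unfolding mem_attribute_complex_iff by blast
  moreover have "insert y \<tau> \<in> ?K" if "\<tau> \<in> ?K" and "\<gamma> \<subseteq> \<tau>" for \<tau>
  proof -
    \<comment> \<open>Any row containing \<open>\<tau>\<close> contains \<open>\<gamma>\<close>,
      hence also the implied \<open>y\<close>: the same \<open>x\<close> witnesses the larger
      simplex.\<close>
    obtain x where "x \<in> X" and "\<tau> \<subseteq> row Y R x"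
      using \<open>\<tau> \<in> ?K\<close> by (auto simp: mem_attribute_complex_iff)
    then have "x \<in> psi X R \<gamma>"
      using \<open>\<gamma> \<subseteq> \<tau>\<close> by (simp add: mem_psi_iff[OF \<open>\<gamma> \<subseteq> Y\<close>])
    then have "y \<in> row Y R x" using y by (simp add: mem_phi_iff)
    then show ?thesis
      using \<open>x \<in> X\<close> \<open>\<tau> \<subseteq> row Y R x\<close> by (auto simp: mem_attribute_complex_iff)
  qed
  ultimately have "\<exists>\<sigma>. free_face ?K \<sigma>"
    using \<open>\<gamma> \<in> ?K\<close> \<open>y \<notin> \<gamma>\<close> by (intro free_face_if_always_extendable)
  with assms show False by blast
qed

end
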